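(* Let $(X,d)$ and $(Y,e)$ be metric spaces, $E\subseteq X$, $f:E\to Y$, $K,L\subseteq\mathbb N$, $\alpha:K\to X$, $\beta:L\to Y$ with $\mathrm{rng}(\alpha)$ dense in $X$ and $\mathrm{rng}(\beta)$ dense in $Y$, and let $r_0,r_1,\ldots$ be a computable sequence of positive rationals having $0$ as an accumulation point. Let $S$ be a topological $(\alpha,\beta)$-approximation system for $f$, and let $$S'=\{(k',m',l,n)\in\mathbb N^4\mid k'\in K\ \&\ \exists k,m\,((k,m,l,n)\in S\ \&\ (\alpha(k'),m')<_d(\alpha(k),m))\}.$$ Then $S'$ is a metric $(\alpha,\beta)$-approximation system for $f$.
   Context: For $(x,m),(x',m')\in X\times\mathbb N$, $(x,m)<_d(x',m')$ means $d(x',x)<r_{m'}-r_m$. A topological $(\alpha,\beta)$-approximation system for $f$ is $S\subseteq K\times\mathbb N\times L\times\mathbb N$ such that for every $x\in E$ and $(l,n)\in L\times\mathbb N$: $e(\beta(l),f(x))<r_n$ iff there exist $k,m$ with $(k,m,l,n)\in S$ and $d(\alpha(k),x)<r_m$. A metric $(\alpha,\beta)$-approximation system for $f$ is $S\subseteq K\times\mathbb N\times L\times\mathbb N$ such that for every $x\in E$: (a) for all $(k,m,l,n)\in S$, $d(\alpha(k),x)<r_m$ implies $e(\beta(l),f(x))<r_n$; (b) for every $n$ there is $m$ such that for every $k\in K$ with $d(\alpha(k),x)<r_m$ there is $l$ with $(k,m,l,n)\in S$. *)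

theory Defs
  imports "HOL-Analysis.Analysis"
begin

text \<open>
  The total recursive functions: \<open>recursive_fun n F\<close> says that the restriction of \<open>F\<close> to
  lists of length \<open>n\<close> is an \<open>n\<close>-ary total recursive function. Values of \<open>F\<close> on lists
  of other lengths carry no meaning. Minimization is restricted to regular functions, so that the
  class contains exactly the total recursive functions.
\<close>

inductive recursive_fun :: "nat \<Rightarrow> (nat list \<Rightarrow> nat) \<Rightarrow> bool" where
  zero: "recursive_fun n (\<lambda>xs. 0)"
| succ: "recursive_fun 1 (\<lambda>xs. Suc (hd xs))"
| proj: "i < n \<Longrightarrow> recursive_fun n (\<lambda>xs. xs ! i)"
| comp: "recursive_fun (length gs) f \<Longrightarrow> (\<forall>g\<in>set gs. recursive_fun n g) \<Longrightarrow>
    recursive_fun n (\<lambda>xs. f (map (\<lambda>g. g xs) gs))"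
| prec: "recursive_fun n f \<Longrightarrow> recursive_fun (Suc (Suc n)) g \<Longrightarrow>
    recursive_fun (Suc n) (\<lambda>xs. rec_nat (f (tl xs)) (\<lambda>k v. g (k # v # tl xs)) (hd xs))"
| mu: "recursive_fun (Suc n) f \<Longrightarrow> (\<forall>xs. length xs = n \<longrightarrow> (\<exists>y. f (y # xs) = 0)) \<Longrightarrow>
    recursive_fun n (\<lambda>xs. LEAST y. f (y # xs) = 0)"

definition computable_nat_fun :: "(nat \<Rightarrow> nat) \<Rightarrow> bool" where
  "computable_nat_fun g \<longleftrightarrow> (\<exists>F. recursive_fun 1 F \<and> (\<forall>n. g n = F [n]))"

definition computable_rat_seq :: "(nat \<Rightarrow> rat) \<Rightarrow> bool" where
  "computable_rat_seq r \<longleftrightarrow>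
    (\<exists>s p q. computable_nat_fun s \<and> computable_nat_fun p \<and> computable_nat_fun q \<and>
      (\<forall>n. q n \<noteq> 0 \<and> r n = (- 1) ^ s n * of_nat (p n) / of_nat (q n)))"

definition accumulation_point_of_seq :: "'a::topological_space \<Rightarrow> (nat \<Rightarrow> 'a) \<Rightarrow> bool" where
  "accumulation_point_of_seq a u \<longleftrightarrow>
    (\<forall>U. open U \<longrightarrow> a \<in> U \<longrightarrow> (\<exists>\<^sub>F n in sequentially. u n \<in> U))"

definition formal_ball_less ::
  "('a \<Rightarrow> 'a \<Rightarrow> real) \<Rightarrow> (nat \<Rightarrow> rat) \<Rightarrow> 'a \<times> nat \<Rightarrow> 'a \<times> nat \<Rightarrow> bool" where
  "formal_ball_less d r = (\<lambda>(x, m) (x', m'). d x' x < of_rat (r m') - of_rat (r m))"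

definition topological_approx_system ::
  "('a \<Rightarrow> 'a \<Rightarrow> real) \<Rightarrow> ('b \<Rightarrow> 'b \<Rightarrow> real) \<Rightarrow> (nat \<Rightarrow> rat) \<Rightarrow>
   nat set \<Rightarrow> (nat \<Rightarrow> 'a) \<Rightarrow> nat set \<Rightarrow> (nat \<Rightarrow> 'b) \<Rightarrow>
   'a set \<Rightarrow> ('a \<Rightarrow> 'b) \<Rightarrow> (nat \<times> nat \<times> nat \<times> nat) set \<Rightarrow> bool" where
  "topological_approx_system d e r K \<alpha> L \<beta> E f S \<longleftrightarrow>
    S \<subseteq> K \<times> UNIV \<times> L \<times> UNIV \<and>
    (\<forall>x\<in>E. \<forall>l\<in>L. \<forall>n.
      e (\<beta> l) (f x) < of_rat (r n) \<longleftrightarrow>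
      (\<exists>k m. (k, m, l, n) \<in> S \<and> d (\<alpha> k) x < of_rat (r m)))"

definition metric_approx_system ::
  "('a \<Rightarrow> 'a \<Rightarrow> real) \<Rightarrow> ('b \<Rightarrow> 'b \<Rightarrow> real) \<Rightarrow> (nat \<Rightarrow> rat) \<Rightarrow>
   nat set \<Rightarrow> (nat \<Rightarrow> 'a) \<Rightarrow> nat set \<Rightarrow> (nat \<Rightarrow> 'b) \<Rightarrow>
   'a set \<Rightarrow> ('a \<Rightarrow> 'b) \<Rightarrow> (nat \<times> nat \<times> nat \<times> nat) set \<Rightarrow> bool" where
  "metric_approx_system d e r K \<alpha> L \<beta> E f S \<longleftrightarrow>
    S \<subseteq> K \<times> UNIV \<times> L \<times> UNIV \<and>
    (\<forall>x\<in>E.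
      (\<forall>k m l n. (k, m, l, n) \<in> S \<longrightarrow> d (\<alpha> k) x < of_rat (r m) \<longrightarrow>
        e (\<beta> l) (f x) < of_rat (r n)) \<and>
      (\<forall>n. \<exists>m. \<forall>k\<in>K. d (\<alpha> k) x < of_rat (r m) \<longrightarrow> (\<exists>l. (k, m, l, n) \<in> S)))"

end

theory Submission
  imports Defs
begin

text \<open>
  If \<open>(\<alpha> k', m') <\<^sub>d (\<alpha> k, m)\<close>, then the ball of radius \<open>r m'\<close> about \<open>\<alpha> k'\<close> lies in the
  ball of radius \<open>r m\<close> about \<open>\<alpha> k\<close>, which gives condition (a). For (b), density of \<open>\<beta>\<close> and \<open>S\<close>
  provide some \<open>(k, m, l, n) \<in> S\<close> with \<open>d (\<alpha> k) x < r m\<close>; any \<open>m'\<close> with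
  \<open>2 * r m' < r m - d (\<alpha> k) x\<close> then works for all \<open>k'\<close> simultaneously.
\<close>

text \<open>The half-line below \<epsilon> is an open neighbourhood of 0, so the sequence visits it.
  This supplies arbitrarily small radii.\<close>

lemma accumulation_point_zero_less:
  fixes u :: "nat \<Rightarrow> real"
  assumes "accumulation_point_of_seq 0 u" and "0 < \<epsilon>"
  obtains n where "u n < \<epsilon>"
proof -
  have "\<exists>\<^sub>F n in sequentially. u n \<in> {..<\<epsilon>}"
    using assms unfolding accumulation_point_of_seq_def by (meson lessThan_iff open_lessThan)
  then show ?thesis
    using that by (auto dest: frequently_ex)
qed

text \<open>Every ball about a point of the closure meets the image; symmetry then puts
  \<open>\<beta> l\<close> in the first argument, as in approximation systems.\<close>

lemma (in Metric_space) dense_image_mdist_less: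
  assumes "mtopology closure_of (\<beta> ` L) = M" and "y \<in> M" and "0 < \<epsilon>"
  obtains l where "l \<in> L" and "d (\<beta> l) y < \<epsilon>"
proof -
  have "y \<in> mtopology closure_of (\<beta> ` L)"
    using assms by simp
  then obtain z where "z \<in> \<beta> ` L" "z \<in> mball y \<epsilon>"
    using \<open>0 < \<epsilon>\<close> unfolding metric_closure_of by blast
  then show ?thesis
    using that by (auto simp: commute)
qed

theorem theorem3p38:
  fixes X :: "'a set" and d :: "'a \<Rightarrow> 'a \<Rightarrow> real"
    and Y :: "'b set" and e :: "'b \<Rightarrow> 'b \<Rightarrow> real"
    and E :: "'a set" and f :: "'a \<Rightarrow> 'b"
    and K L :: "nat set" and \<alpha> :: "nat \<Rightarrow> 'a" and \<beta> :: "nat \<Rightarrow> 'b"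
    and r :: "nat \<Rightarrow> rat"
    and S :: "(nat \<times> nat \<times> nat \<times> nat) set"
  assumes "Metric_space X d" and "Metric_space Y e"
    and "E \<subseteq> X" and "f \<in> E \<rightarrow> Y"
    and "\<alpha> \<in> K \<rightarrow> X" and "\<beta> \<in> L \<rightarrow> Y"
    and "Metric_space.mtopology X d closure_of (\<alpha> ` K) = X"
    and "Metric_space.mtopology Y e closure_of (\<beta> ` L) = Y"
    and "computable_rat_seq r" and "\<And>n. 0 < r n"
    and "accumulation_point_of_seq (0::real) (\<lambda>n. of_rat (r n))"
    and "topological_approx_system d e r K \<alpha> L \<beta> E f S"
  shows "metric_approx_system d e r K \<alpha> L \<beta> E f
    {(k', m', l, n). k' \<in> K \<and>
      (\<exists>k m. (k, m, l, n) \<in> S \<and> formal_ball_less d r (\<alpha> k', m') (\<alpha> k, m))}"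
    (is "metric_approx_system _ _ _ _ _ _ _ _ _ ?S'")
  unfolding metric_approx_system_def
proof (intro conjI ballI allI impI)
  interpret X: Metric_space X d by fact
  interpret Y: Metric_space Y e by fact
  have S_sub: "S \<subseteq> K \<times> UNIV \<times> L \<times> UNIV"
    and S_iff: "\<And>x l n. x \<in> E \<Longrightarrow> l \<in> L \<Longrightarrow>
      e (\<beta> l) (f x) < of_rat (r n) \<longleftrightarrow> (\<exists>k m. (k, m, l, n) \<in> S \<and> d (\<alpha> k) x < of_rat (r m))"
    using assms(12) unfolding topological_approx_system_def by auto
  have \<alpha>_in: "\<alpha> k \<in> X" if "k \<in> K" for k
    using that assms(5) by auto
  show "?S' \<subseteq> K \<times> UNIV \<times> L \<times> UNIV"
    using S_sub by auto
  fix x assume x: "x \<in> E"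
  then have xX: "x \<in> X"
    using assms(3) by auto
  {
    fix k' m' l n
    assume "(k', m', l, n) \<in> ?S'" and near: "d (\<alpha> k') x < of_rat (r m')"
    then obtain k m where k': "k' \<in> K" and S: "(k, m, l, n) \<in> S"
      and less: "d (\<alpha> k) (\<alpha> k') < of_rat (r m) - of_rat (r m')"
      by (auto simp: formal_ball_less_def)
    have kl: "k \<in> K" "l \<in> L"
      using S S_sub by auto
    have "d (\<alpha> k) x \<le> d (\<alpha> k) (\<alpha> k') + d (\<alpha> k') x"
      using X.triangle \<alpha>_in k' kl xX by blast
    then have "d (\<alpha> k) x < of_rat (r m)"
      using near less by linarith
    \<comment> \<open>Here \<open>S_iff\<close> is read from right to left, with \<open>k\<close>
      and \<open>m\<close> as witnesses.\<close>
    then show "e (\<beta> l) (f x) < of_rat (r n)"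
      using S S_iff x kl by blast
  next
    fix n
    have "f x \<in> Y" and "0 < real_of_rat (r n)"
      using x assms(4,10) by auto
    then obtain l where l: "l \<in> L" "e (\<beta> l) (f x) < of_rat (r n)"
      using Y.dense_image_mdist_less assms(8) by metis
    then obtain k m where S: "(k, m, l, n) \<in> S" and near: "d (\<alpha> k) x < of_rat (r m)"
      using S_iff x by blast
    then have k: "k \<in> K"
      using S_sub by auto
    \<comment> \<open>The slack is halved because \<open>r m'\<close> is spent twice: once to bound
      the distance from \<open>\<alpha> k'\<close> to \<open>x\<close>, once as the radius
      subtracted in \<open>formal_ball_less\<close>.\<close>
    obtain m' where m': "of_rat (r m') < (of_rat (r m) - d (\<alpha> k) x) / 2"
      using accumulation_point_zero_less[OF assms(11), of "(of_rat (r m) - d (\<alpha> k) x) / 2"] near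
      by auto
    \<comment> \<open>Both \<open>m'\<close> and \<open>l\<close> were fixed before
      \<open>k'\<close>, so a single \<open>l\<close> serves every centre near \<open>x\<close>,
      although (b) would let it vary with \<open>k'\<close>.\<close>
    have "(k', m', l, n) \<in> ?S'" if k': "k' \<in> K" and "d (\<alpha> k') x < of_rat (r m')" for k'
    proof -
      have "d (\<alpha> k) (\<alpha> k') \<le> d (\<alpha> k) x + d (\<alpha> k') x"
        using X.triangle[of "\<alpha> k" x "\<alpha> k'"] \<alpha>_in k k' xX by (simp add: X.commute)
      then have "d (\<alpha> k) (\<alpha> k') < of_rat (r m) - of_rat (r m')"
        using that m' by (simp add: field_simps)
      then show ?thesis
        using S k' by (auto simp: formal_ball_less_def)
    qed
    then show "\<exists>m'. \<forall>k'\<in>K. d (\<alpha> k') x < of_rat (r m') \<longrightarrow> (\<exists>l. (k', m', l, n) \<in> ?S')"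
      by blast
  }
qed

end
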